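(* Let $r\ge0$ be an integer, and let $G_r(z,v)=\sum_{\tau} z^{|\tau|} v^{|\rho^r(\tau)|}$, the sum over all Catalan--Stanley trees $\tau$, where $|\cdot|$ denotes the number of nodes. Then, with $T=T(z)=\frac{1-\sqrt{1-4z}}{2}$ and $S(z,t)=z+\frac{zt}{1-t-T(z)^2}$, \[ G_r(z,v) = \frac{1}{1 - z\,\frac{1-T^{2r}}{1-T^{2}}}\; S\bigg(zv,\; \frac{z\,T^{2r}}{1 - z\,\frac{1-T^{2r}}{1-T^{2}}}\,v\bigg), \] where in $S(zv,\cdot)$ the function $T$ inside $S$ is evaluated at the first argument $zv$.
   Context: A rooted plane tree has ordered children at every node. For each child $c$ of the root, the rightmost leaf of the branch at $c$ is the leaf reached from $c$ by repeatedly moving to the rightmost child. A Catalan--Stanley tree is a rooted plane tree in which every such rightmost leaf has odd distance to the root (the one-node tree is included). $S(z,t)$ is the generating function of Catalan--Stanley trees with $t$ marking these rightmost leaves and $z$ marking all other nodes. The reduction $\rho$: for each rightmost leaf $\ell$ of a branch attached to the root, if $\ell$ is a child of the root it is deleted; otherwise all descendants of the grandparent of $\ell$ are deleted (the grandparent becomes a leaf); the one-node tree is mapped to itself. $\rho^r(\tau)$ is called the $r$-fold reduced tree ($r$th ancestor) of $\tau$. $T(z)$ is the generating function of rooted plane trees by number of nodes. *)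

theory Defs
  imports Complex_Main "HOL-Computational_Algebra.Formal_Power_Series"
begin

datatype ptree = Node "ptree list"

primrec children :: "ptree \<Rightarrow> ptree list" where
  "children (Node ts) = ts"

fun nodes :: "ptree \<Rightarrow> nat" where
  "nodes (Node ts) = Suc (\<Sum>t\<leftarrow>ts. nodes t)"

text \<open>Distance from the root of a tree to the leaf reached by always moving to the rightmost child.\<close>

function rightmost_dist :: "ptree \<Rightarrow> nat" where
  "rightmost_dist (Node ts) = (if ts = [] then 0 else Suc (rightmost_dist (last ts)))"
  by pat_completeness auto
termination
  by (relation "measure size") (auto dest!: last_in_set intro: size_list_estimation' simp: less_Suc_eq_le)

definition catalan_stanley :: "ptree \<Rightarrow> bool" where
  "catalan_stanley t \<longleftrightarrow> (\<forall>c \<in> set (children t). odd (Suc (rightmost_dist c)))"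

text \<open>\<open>cut c\<close> turns the grandparent of the rightmost leaf of the branch \<open>c\<close> into a leaf. In a
  Catalan--Stanley tree a branch \<open>c\<close> other than a single leaf has \<open>rightmost_dist c \<ge> 2\<close>, so
  that the grandparent belongs to \<open>c\<close>; the values of \<open>cut\<close> on other trees are irrelevant.\<close>

function cut :: "ptree \<Rightarrow> ptree" where
  "cut (Node ts) =
     (if rightmost_dist (Node ts) \<le> 2 then Node []
      else Node (butlast ts @ [cut (last ts)]))"
  by pat_completeness auto
termination
  by (relation "measure size")
    (auto dest!: last_in_set intro: size_list_estimation' simp: less_Suc_eq_le split: if_splits)

definition reduce :: "ptree \<Rightarrow> ptree" where
  "reduce t = Node (map cut (filter (\<lambda>c. c \<noteq> Node []) (children t)))"

text \<open>Bivariate generating functions live in \<open>\<real>[[v]][[z]]\<close>: the outer series variable is \<open>z\<close>, the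
  inner one is \<open>v\<close>.\<close>

abbreviation z_var :: "real fps fps" where
  "z_var \<equiv> fps_X"

abbreviation v_var :: "real fps fps" where
  "v_var \<equiv> fps_const fps_X"

text \<open>The coefficient of \<open>z\<^sup>n\<close> is a sum over the trees with \<open>n\<close> nodes, a finite set by
  \<open>finite_nodes_eq\<close> below.\<close>

definition G :: "nat \<Rightarrow> real fps fps" where
  "G r = Abs_fps (\<lambda>n. \<Sum>t | catalan_stanley t \<and> nodes t = n. fps_X ^ nodes ((reduce ^^ r) t))"

definition T_series :: "real fps" where
  "T_series = (1 - fps_radical root 2 (1 - 4 * fps_X)) / 2"

text \<open>Substitution of \<open>x\<close>, a bivariate series without constant term in \<open>z\<close>, for the variable
  of \<open>T_series\<close>.\<close>

definition T :: "real fps fps \<Rightarrow> real fps fps" where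
  "T x = fps_compose (Abs_fps (\<lambda>n. fps_const (fps_nth T_series n))) x"

text \<open>All quotients occurring here and in the main statement have denominators with constant
  term \<open>1\<close> in \<open>z\<close>, so that \<open>/\<close> is multiplication with the inverse series.\<close>

definition S :: "real fps fps \<Rightarrow> real fps fps \<Rightarrow> real fps fps" where
  "S x t = x + x * t / (1 - t - (T x)\<^sup>2)"

lemma finite_nodes_le: "finite {t. nodes t \<le> n}"
proof (induction n)
  case 0
  have "\<not> nodes t \<le> 0" for t by (cases t) auto
  then have "{t. nodes t \<le> 0} = {}" by blast
  then show ?case by (simp only: finite.emptyI)
next
  case (Suc n)
  have pos: "1 \<le> nodes t" for t by (cases t) auto
  have len: "length ts \<le> (\<Sum>t\<leftarrow>ts. nodes t)" for ts
  proof (induction ts)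
    case (Cons a ts)
    then show ?case using pos[of a] by simp
  qed simp
  have "{t. nodes t \<le> Suc n} \<subseteq> Node ` {ts. set ts \<subseteq> {t. nodes t \<le> n} \<and> length ts \<le> n}"
  proof
    fix t assume t: "t \<in> {t. nodes t \<le> Suc n}"
    obtain ts where ts: "t = Node ts" by (cases t)
    have s: "(\<Sum>t\<leftarrow>ts. nodes t) \<le> n" using t ts by simp
    have "nodes u \<le> n" if "u \<in> set ts" for u
      using member_le_sum_list[of "nodes u" "map nodes ts"] that s by simp
    then show "t \<in> Node ` {ts. set ts \<subseteq> {t. nodes t \<le> n} \<and> length ts \<le> n}"
      using ts s len[of ts] by auto
  qed
  moreover have "finite (Node ` {ts. set ts \<subseteq> {t. nodes t \<le> n} \<and> length ts \<le> n})"
    by (intro finite_imageI finite_lists_length_le Suc.IH)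
  ultimately show ?case by (rule finite_subset)
qed

lemma finite_nodes_eq: "finite {t. catalan_stanley t \<and> nodes t = n}"
  by (rule finite_subset[OF _ finite_nodes_le[of n]]) auto

end

theory Submission imports Defs begin

text \<open>Appending a branch \<open>c\<close> to the right of a tree \<open>t\<close> gives a bijection between pairs of trees
  and trees with more than one node. It adds up node counts and raises the rightmost distance of
  \<open>c\<close> by one, so every class of trees below satisfies a linear or quadratic equation. Iterated
  reduction acts on branches independently: a branch with even rightmost distance \<open>d\<close> disappears
  under \<open>\<rho>\<^sup>r\<close> if \<open>d < 2r\<close>, and otherwise loses the lowest \<open>2r\<close> levels of its rightmost path. The
  former branches contribute \<open>z (1 - T\<^sup>2\<^sup>r) / (1 - T\<^sup>2)\<close> and the latter
  \<open>z v T\<^sup>2\<^sup>r / (1 - T(zv)\<^sup>2)\<close>, because the surviving part of the rightmost path is counted by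
  powers of \<open>T(zv)\<close> and the deleted part by \<open>T\<^sup>2\<^sup>r\<close>. Then \<open>G = z v + G * B\<close>, where \<open>B\<close> is the sum
  of the two contributions.\<close>

section \<open>Appending a rightmost branch\<close>

definition append_branch :: "ptree \<Rightarrow> ptree \<Rightarrow> ptree" where
  "append_branch t c = Node (children t @ [c])"

definition append_branches :: "ptree set \<Rightarrow> ptree set \<Rightarrow> ptree set" where
  "append_branches A B = (\<lambda>(t, c). append_branch t c) ` (A \<times> B)"

lemma append_branch_cases:
  obtains "t = Node []" | s c where "t = append_branch s c"
proof (cases t)
  case (Node ts)
  show thesis
  proof (cases ts rule: rev_cases)
    case Nil
    with Node that(1) show thesis by simp
  next
    case (snoc us c)
    with Node that(2)[of "Node us" c] show thesis by (simp add: append_branch_def)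
  qed
qed

lemma append_branch_neq_leaf [simp]:
  "append_branch t c \<noteq> Node []" "Node [] \<noteq> append_branch t c"
  by (auto simp: append_branch_def)

lemma append_branch_inject [simp]:
  "append_branch s b = append_branch t c \<longleftrightarrow> s = t \<and> b = c"
  by (cases s; cases t) (auto simp: append_branch_def)

lemma append_branch_in_append_branches_iff [simp]:
  "append_branch t c \<in> append_branches A B \<longleftrightarrow> t \<in> A \<and> c \<in> B"
  by (auto simp: append_branches_def)

lemma leaf_notin_append_branches [simp]: "Node [] \<notin> append_branches A B"
  by (auto simp: append_branches_def)

lemma nodes_append_branch [simp]: "nodes (append_branch t c) = nodes t + nodes c"
  by (cases t) (simp add: append_branch_def)

lemma nodes_pos [simp]: "0 < nodes t"
  by (cases t) simp

lemma rightmost_dist_append_branch [simp]: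
  "rightmost_dist (append_branch t c) = Suc (rightmost_dist c)"
  by (simp add: append_branch_def)

lemma rightmost_dist_eq_0_iff [simp]: "rightmost_dist t = 0 \<longleftrightarrow> t = Node []"
  by (cases t rule: append_branch_cases) auto

lemma catalan_stanley_leaf [simp]: "catalan_stanley (Node [])"
  by (simp add: catalan_stanley_def)

lemma catalan_stanley_append_branch [simp]:
  "catalan_stanley (append_branch t c) \<longleftrightarrow> catalan_stanley t \<and> even (rightmost_dist c)"
  by (auto simp: catalan_stanley_def append_branch_def)

section \<open>Iterated reduction\<close>

lemma cut_append_branch:
  "cut (append_branch t c) =
    (if rightmost_dist c \<le> 1 then Node [] else append_branch t (cut c))"
  by (simp add: append_branch_def)

text \<open>Truncated subtraction covers branches of distance at most 2, which become a leaf.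
  Otherwise \<open>cut\<close> descends into the last branch, which has fewer nodes and distance at
  least 2, so that taking the successor commutes with subtracting 2.\<close>

lemma rightmost_dist_cut [simp]: "rightmost_dist (cut c) = rightmost_dist c - 2"
proof (induction "nodes c" arbitrary: c rule: less_induct)
  case less
  show ?case
  proof (cases c rule: append_branch_cases)
    case (2 t b)
    then show ?thesis using less[of b] by (auto simp: cut_append_branch)
  qed auto
qed

lemma rightmost_dist_cut_funpow:
  "rightmost_dist ((cut ^^ r) c) = rightmost_dist c - 2 * r"
  by (induction r) auto

text \<open>After fewer than \<open>r\<close> cuts, \<open>c\<close> still has distance at least 2,
  so the next cut again acts entirely inside \<open>c\<close>.\<close>

lemma cut_funpow_append_branch:
  "2 * r \<le> rightmost_dist c \<Longrightarrow> (cut ^^ r) (append_branch t c) = append_branch t ((cut ^^ r) c)"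
  by (induction r) (auto simp: cut_append_branch rightmost_dist_cut_funpow)

lemma cut_funpow_eq_leaf:
  "rightmost_dist c = 2 * r \<Longrightarrow> (cut ^^ r) c = Node []"
  by (simp flip: rightmost_dist_eq_0_iff add: rightmost_dist_cut_funpow)

lemma reduce_leaf [simp]: "reduce (Node []) = Node []"
  by (simp add: reduce_def)

lemma reduce_funpow_leaf [simp]: "(reduce ^^ r) (Node []) = Node []"
  by (induction r) auto

lemma reduce_append_branch:
  "reduce (append_branch t c) = (if c = Node [] then reduce t else append_branch (reduce t) (cut c))"
  by (simp add: reduce_def append_branch_def)

text \<open>Peeling off the first reduction either deletes a leaf \<open>c\<close> or replaces it by
  \<open>cut c\<close>, whose distance is again even and smaller by 2; this matches the threshold
  for one reduction fewer.\<close>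

lemma reduce_funpow_append_branch:
  "even (rightmost_dist c) \<Longrightarrow> (reduce ^^ r) (append_branch t c) =
    (if 2 * r \<le> rightmost_dist c then append_branch ((reduce ^^ r) t) ((cut ^^ r) c)
     else (reduce ^^ r) t)"
proof (induction r arbitrary: t c)
  case (Suc r)
  show ?case
  proof (cases "c = Node []")
    case False
    then have "rightmost_dist c \<noteq> 0" by simp
    then have "2 \<le> rightmost_dist c" using Suc.prems by presburger
    with False Suc show ?thesis
      by (auto simp: funpow_Suc_right reduce_append_branch simp del: funpow.simps)
  qed (simp add: funpow_Suc_right reduce_append_branch del: funpow.simps)
qed simp

section \<open>Weighted generating functions of classes of trees\<close>

text \<open>The outer variable always marks the nodes of the original tree. The weight carries the
  statistic in v: it is constantly 1 for plain counting and a power of v for the size after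
  reduction.\<close>

definition tree_gf :: "(ptree \<Rightarrow> 'a::comm_ring_1) \<Rightarrow> ptree set \<Rightarrow> 'a fps" where
  "tree_gf w A = Abs_fps (\<lambda>n. \<Sum>t | t \<in> A \<and> nodes t = n. w t)"

lemma tree_gf_nth: "fps_nth (tree_gf w A) n = (\<Sum>t | t \<in> A \<and> nodes t = n. w t)"
  by (simp add: tree_gf_def)

lemma finite_tree_class [simp]: "finite {t. t \<in> A \<and> nodes t = n}"
  by (rule finite_subset[OF _ finite_nodes_le[of n]]) auto

lemma tree_gf_nth_0 [simp]: "fps_nth (tree_gf w A) 0 = 0"
  by (simp add: tree_gf_nth sum.neutral less_imp_neq[symmetric])

lemma tree_gf_cong:
  "A = B \<Longrightarrow> (\<And>t. t \<in> B \<Longrightarrow> w t = w' t) \<Longrightarrow> tree_gf w A = tree_gf w' B"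
  unfolding tree_gf_def by (intro arg_cong[of _ _ Abs_fps] ext sum.cong) auto

lemma tree_gf_const: "tree_gf (\<lambda>_. x) A = fps_const x * tree_gf (\<lambda>_. 1) A"
  by (rule fps_ext) (simp add: tree_gf_nth mult.commute)

lemma tree_gf_leaf: "tree_gf w {Node []} = fps_X * fps_const (w (Node []))"
proof (rule fps_ext)
  fix n
  have "{t. t \<in> {Node []} \<and> nodes t = n} = (if n = 1 then {Node []} else {})"
    by auto
  then show "fps_nth (tree_gf w {Node []}) n = fps_nth (fps_X * fps_const (w (Node []))) n"
    by (simp add: tree_gf_nth)
qed

lemma tree_gf_Un:
  assumes "A \<inter> B = {}"
  shows "tree_gf w (A \<union> B) = tree_gf w A + tree_gf w B"
proof (rule fps_ext)
  fix n
  have "{t. t \<in> A \<union> B \<and> nodes t = n} = {t. t \<in> A \<and> nodes t = n} \<union> {t. t \<in> B \<and> nodes t = n}"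
    by auto
  then show "fps_nth (tree_gf w (A \<union> B)) n = fps_nth (tree_gf w A + tree_gf w B) n"
    using assms by (auto simp: tree_gf_nth intro!: sum.union_disjoint)
qed

text \<open>The weights of the two factors may differ from \<open>w\<close>, because iterated
  reduction acts on the left tree by \<open>reduce\<close> but on the appended branch by
  \<open>cut\<close>.\<close>

lemma tree_gf_append_branches:
  assumes "\<And>t c. t \<in> A \<Longrightarrow> c \<in> B \<Longrightarrow> w (append_branch t c) = u t * u' c"
  shows "tree_gf w (append_branches A B) = tree_gf u A * tree_gf u' B"
proof (rule fps_ext)
  fix n
  \<comment> \<open>These are the index triples of the Cauchy product. The map to trees forgets
    \<open>i\<close> and stays injective, since \<open>i\<close> is the node count of the left
    tree.\<close>
  define I where "I = (SIGMA i:{0..n}. {t. t \<in> A \<and> nodes t = i} \<times> {c. c \<in> B \<and> nodes c = n - i})"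
  have "fps_nth (tree_gf u A * tree_gf u' B) n =
      (\<Sum>i=0..n. \<Sum>p\<in>{t. t \<in> A \<and> nodes t = i} \<times> {c. c \<in> B \<and> nodes c = n - i}.
        u (fst p) * u' (snd p))"
    by (simp add: fps_mult_nth tree_gf_nth sum_product sum.cartesian_product case_prod_beta)
  also have "\<dots> = (\<Sum>q\<in>I. u (fst (snd q)) * u' (snd (snd q)))"
    unfolding I_def by (subst sum.Sigma) (auto simp: case_prod_beta)
  also have "\<dots> = (\<Sum>t | t \<in> append_branches A B \<and> nodes t = n. w t)"
  proof -
    have "bij_betw (\<lambda>q. append_branch (fst (snd q)) (snd (snd q))) I
        {t. t \<in> append_branches A B \<and> nodes t = n}"
      unfolding bij_betw_def inj_on_def
      by (force simp: I_def append_branches_def image_iff)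
    then have "(\<Sum>q\<in>I. w (append_branch (fst (snd q)) (snd (snd q)))) =
        (\<Sum>t | t \<in> append_branches A B \<and> nodes t = n. w t)"
      by (rule sum.reindex_bij_betw)
    moreover have "(\<Sum>q\<in>I. u (fst (snd q)) * u' (snd (snd q))) =
        (\<Sum>q\<in>I. w (append_branch (fst (snd q)) (snd (snd q))))"
      by (rule sum.cong) (auto simp: I_def assms)
    ultimately show ?thesis
      by simp
  qed
  finally show "fps_nth (tree_gf w (append_branches A B)) n =
      fps_nth (tree_gf u A * tree_gf u' B) n"
    by (simp add: tree_gf_nth)
qed

section \<open>The series of all plane trees\<close>

text \<open>Two solutions satisfy (f - g)(1 - f - g) = 0, and the second factor has constant term 1,
  hence is nonzero.\<close>

lemma quadratic_fps_unique:
  fixes f g :: "'a::idom fps"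
  assumes "f = x + f\<^sup>2" "g = x + g\<^sup>2" "fps_nth f 0 = 0" "fps_nth g 0 = 0"
  shows "f = g"
proof -
  have "f - g = f\<^sup>2 - g\<^sup>2"
    using assms(1,2) by (metis add_diff_cancel_left)
  then have "(f - g) * (1 - f - g) = 0"
    by (simp add: algebra_simps power2_eq_square)
  moreover have "fps_nth (1 - f - g) 0 = 1"
    using assms(3,4) by simp
  then have "1 - f - g \<noteq> 0"
    by force
  ultimately show ?thesis
    by simp
qed

lemma T_series_nth_0: "fps_nth T_series 0 = 0"
  by (simp add: T_series_def fps_divide_unit numeral_fps_const fps_const_inverse)

lemma T_series_quadratic: "T_series = fps_X + T_series\<^sup>2"
proof -
  define R :: "real fps" where "R = fps_radical root 2 (1 - 4 * fps_X)"
  have "R\<^sup>2 = 1 - 4 * fps_X"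
    using power_radical[of "1 - 4 * fps_X :: real fps" root 1]
    by (simp add: R_def numeral_2_eq_2)
  moreover have "2 * T_series = 1 - R"
    unfolding T_series_def R_def [symmetric]
    using fps_times_divide_eq[of 2 "1 - R"] by (simp add: mult.commute)
  ultimately have "(1 - 2 * T_series)\<^sup>2 = 1 - 4 * fps_X"
    by simp
  then have "4 * T_series = 4 * (fps_X + T_series\<^sup>2)"
    by (simp add: power2_eq_square algebra_simps)
  moreover have "(4 :: real fps) \<noteq> 0"
    by simp
  ultimately show ?thesis
    by (metis mult_left_cancel)
qed

lemma T_quadratic:
  assumes "fps_nth x 0 = 0"
  shows "T x = x + (T x)\<^sup>2"
proof -
  define L :: "real fps fps" where "L = Abs_fps (\<lambda>n. fps_const (fps_nth T_series n))"
  have "L = fps_X + L\<^sup>2"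
  proof (rule fps_ext)
    fix n
    \<comment> \<open>\<open>fps_const\<close> respects finite sums, so lifting the coefficients of
      \<open>T_series\<close> to constants in v preserves Cauchy products.\<close>
    have *: "fps_const (\<Sum>i\<in>A. f i) = (\<Sum>i\<in>A. fps_const (f i))"
      for f :: "nat \<Rightarrow> real" and A
      by (induction A rule: infinite_finite_induct) (simp_all flip: fps_const_add)
    have "fps_const (fps_nth T_series n) = fps_const (fps_nth (fps_X + T_series\<^sup>2) n)"
      using T_series_quadratic by simp
    then show "fps_nth L n = fps_nth (fps_X + L\<^sup>2) n"
      by (simp add: L_def power2_eq_square fps_mult_nth * flip: fps_const_add fps_const_mult)
  qed
  then have "fps_compose L x = fps_compose (fps_X + L\<^sup>2) x"
    by simp
  then show ?thesis
    using assms
    by (simp add: T_def flip: L_def)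
      (simp add: fps_compose_add_distrib fps_compose_mult_distrib power2_eq_square)
qed

lemma T_nth_0: "fps_nth (T x) 0 = 0"
  by (simp add: T_def T_series_nth_0)

text \<open>A tree is a leaf or an appended pair of trees, so this series solves the same quadratic
  equation as T(zx), and both vanish at z = 0.\<close>

lemma tree_gf_all_trees:
  fixes x :: "real fps"
  shows "tree_gf (\<lambda>t. x ^ nodes t) UNIV = T (fps_X * fps_const x)"
proof (rule quadratic_fps_unique)
  let ?w = "\<lambda>t. x ^ nodes t"
  have "t \<in> {Node []} \<union> append_branches UNIV UNIV" for t
    by (cases t rule: append_branch_cases) auto
  then have "UNIV = {Node []} \<union> append_branches UNIV UNIV"
    by blast
  then have "tree_gf ?w UNIV = tree_gf ?w ({Node []} \<union> append_branches UNIV UNIV)"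
    by (rule arg_cong)
  also have "\<dots> = fps_X * fps_const x + (tree_gf ?w UNIV)\<^sup>2"
    by (subst tree_gf_Un) (simp_all add: tree_gf_leaf power2_eq_square power_add
        tree_gf_append_branches[where u = ?w and u' = ?w])
  finally show "tree_gf ?w UNIV = fps_X * fps_const x + (tree_gf ?w UNIV)\<^sup>2" .
qed (auto simp: T_quadratic[symmetric] T_nth_0)

lemma tree_gf_all_trees_unweighted: "tree_gf (\<lambda>_. 1 :: real fps) UNIV = T fps_X"
  using tree_gf_all_trees[of 1] by simp

section \<open>The series of branches\<close>

text \<open>Each of the \<open>k\<close> edges of the rightmost path leaves an arbitrary tree at its
  upper end, giving a factor T; the final leaf gives z.\<close>

lemma tree_gf_rightmost_dist_eq:
  "tree_gf (\<lambda>_. 1 :: real fps) {c. rightmost_dist c = k} = fps_X * T fps_X ^ k"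
proof (induction k)
  case (Suc k)
  have "{c. rightmost_dist c = Suc k} = append_branches UNIV {c. rightmost_dist c = k}"
  proof (rule set_eqI)
    fix c show "c \<in> {c. rightmost_dist c = Suc k} \<longleftrightarrow>
        c \<in> append_branches UNIV {c. rightmost_dist c = k}"
      by (cases c rule: append_branch_cases) auto
  qed
  then show ?case
    by (simp add: tree_gf_append_branches[where u = "\<lambda>_. 1" and u' = "\<lambda>_. 1"]
        Suc tree_gf_all_trees_unweighted mult.left_commute)
qed (simp add: tree_gf_leaf)

lemma tree_gf_short_branches:
  "tree_gf (\<lambda>_. 1 :: real fps) {c. even (rightmost_dist c) \<and> rightmost_dist c < 2 * r} =
    fps_X * (\<Sum>j<r. ((T fps_X)\<^sup>2) ^ j)"
proof (induction r)
  case 0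
  show ?case by (simp add: tree_gf_def fps_zero_def)
next
  case (Suc r)
  have "{c. even (rightmost_dist c) \<and> rightmost_dist c < 2 * Suc r} =
      {c. even (rightmost_dist c) \<and> rightmost_dist c < 2 * r} \<union> {c. rightmost_dist c = 2 * r}"
    by (auto; presburger)
  then have "tree_gf (\<lambda>_. 1 :: real fps) {c. even (rightmost_dist c) \<and> rightmost_dist c < 2 * Suc r} =
      tree_gf (\<lambda>_. 1) {c. even (rightmost_dist c) \<and> rightmost_dist c < 2 * r} +
      tree_gf (\<lambda>_. 1) {c. rightmost_dist c = 2 * r}"
    by (simp only:) (rule tree_gf_Un, auto)
  then show ?case
    by (simp only: Suc tree_gf_rightmost_dist_eq power_mult sum.lessThan_Suc distrib_left)
qed

text \<open>Distance exactly \<open>2 * r\<close> is the base case: the whole branch shrinks to one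
  node, of weight v. In a longer branch the top two levels are untouched by the cuts, so each
  contributes T(zv), its nodes being counted both before and after reduction.\<close>

lemma tree_gf_long_branches:
  fixes r :: nat
  defines "E \<equiv> tree_gf (\<lambda>c. fps_X ^ nodes ((cut ^^ r) c))
    {c. even (rightmost_dist c) \<and> 2 * r \<le> rightmost_dist c}"
  shows "E = z_var * v_var * T z_var ^ (2 * r) + (T (z_var * v_var))\<^sup>2 * E"
proof -
  let ?w = "\<lambda>c. (fps_X :: real fps) ^ nodes ((cut ^^ r) c)"
  let ?A = "{c. even (rightmost_dist c) \<and> 2 * r \<le> rightmost_dist c}"
  have step: "tree_gf ?w (append_branches UNIV A) = T (z_var * v_var) * tree_gf ?w A"
    if "A \<subseteq> {c. 2 * r \<le> rightmost_dist c}" for A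
    unfolding tree_gf_all_trees[symmetric] using that
    by (intro tree_gf_append_branches) (auto simp: cut_funpow_append_branch power_add)
  \<comment> \<open>By parity, a distance above \<open>2 * r\<close> exceeds it by at least 2, so
    removing two levels stays in the class.\<close>
  have split: "?A = {c. rightmost_dist c = 2 * r} \<union> append_branches UNIV (append_branches UNIV ?A)"
  proof (rule set_eqI)
    fix c
    show "c \<in> ?A \<longleftrightarrow>
        c \<in> {c. rightmost_dist c = 2 * r} \<union> append_branches UNIV (append_branches UNIV ?A)"
    proof (cases c rule: append_branch_cases)
      case (2 t b)
      then show ?thesis
        by (cases b rule: append_branch_cases) (auto; presburger)+
    qed auto
  qed
  have "E = tree_gf ?w {c. rightmost_dist c = 2 * r} +
      tree_gf ?w (append_branches UNIV (append_branches UNIV ?A))"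
    unfolding E_def by (subst split, rule tree_gf_Un) (auto simp: append_branches_def)
  also have "tree_gf ?w {c. rightmost_dist c = 2 * r} =
      tree_gf (\<lambda>_. fps_X) {c. rightmost_dist c = 2 * r}"
    by (rule tree_gf_cong) (auto simp: cut_funpow_eq_leaf)
  also have "\<dots> = z_var * v_var * T z_var ^ (2 * r)"
    by (subst tree_gf_const) (simp add: tree_gf_rightmost_dist_eq mult_ac)
  also have "tree_gf ?w (append_branches UNIV (append_branches UNIV ?A)) =
      T (z_var * v_var) * (T (z_var * v_var) * E)"
    unfolding E_def by (subst step, force simp: append_branches_def, subst step) auto
  finally show ?thesis
    by (simp add: power2_eq_square mult.assoc)
qed

lemma G_linear_equation:
  "G r = z_var * v_var + G r *
    (tree_gf (\<lambda>_. 1) {c. even (rightmost_dist c) \<and> rightmost_dist c < 2 * r} +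
     tree_gf (\<lambda>c. fps_X ^ nodes ((cut ^^ r) c))
       {c. even (rightmost_dist c) \<and> 2 * r \<le> rightmost_dist c})"
proof -
  let ?W = "\<lambda>t. (fps_X :: real fps) ^ nodes ((reduce ^^ r) t)"
  \<comment> \<open>A branch that vanishes adds nothing to the reduced size, hence weight 1.\<close>
  let ?u = "\<lambda>c. if 2 * r \<le> rightmost_dist c then (fps_X :: real fps) ^ nodes ((cut ^^ r) c) else 1"
  let ?even = "{c. even (rightmost_dist c)}"
  let ?short = "{c. even (rightmost_dist c) \<and> rightmost_dist c < 2 * r}"
  let ?long = "{c. even (rightmost_dist c) \<and> 2 * r \<le> rightmost_dist c}"
  have G: "G r = tree_gf ?W {t. catalan_stanley t}"
    by (simp add: G_def tree_gf_def)
  have "{t. catalan_stanley t} = {Node []} \<union> append_branches {t. catalan_stanley t} ?even"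
  proof (rule set_eqI)
    fix t
    show "t \<in> {t. catalan_stanley t} \<longleftrightarrow>
        t \<in> {Node []} \<union> append_branches {t. catalan_stanley t} ?even"
      by (cases t rule: append_branch_cases) auto
  qed
  then have "G r = tree_gf ?W ({Node []} \<union> append_branches {t. catalan_stanley t} ?even)"
    unfolding G by (rule arg_cong)
  also have "\<dots> = z_var * v_var + tree_gf ?W (append_branches {t. catalan_stanley t} ?even)"
    by (subst tree_gf_Un) (simp_all add: tree_gf_leaf)
  also have "tree_gf ?W (append_branches {t. catalan_stanley t} ?even) = G r * tree_gf ?u ?even"
    unfolding G by (intro tree_gf_append_branches)
      (auto simp: reduce_funpow_append_branch power_add)
  also have "tree_gf ?u ?even = tree_gf ?u (?short \<union> ?long)"
    by (rule tree_gf_cong) auto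
  also have "\<dots> = tree_gf ?u ?short + tree_gf ?u ?long"
    by (rule tree_gf_Un) auto
  also have "tree_gf ?u ?short = tree_gf (\<lambda>_. 1) ?short"
    by (rule tree_gf_cong) auto
  also have "tree_gf ?u ?long = tree_gf (\<lambda>c. fps_X ^ nodes ((cut ^^ r) c)) ?long"
    by (rule tree_gf_cong) auto
  finally show ?thesis .
qed

section \<open>Solving for the generating function\<close>

text \<open>The coefficients are themselves power series and form no field; constant term 1 is what
  makes the denominator a unit.\<close>

lemma fps_divide_mult_cancel:
  fixes f g :: "'a::field fps fps"
  assumes "fps_nth g 0 = 1"
  shows "f / g * g = f"
proof -
  have "g * inverse g = 1"
    using assms fps_right_inverse[of g 1] by (simp add: fps_inverse_def[of g])
  then show ?thesis
    using assms by (simp add: fps_divide_unit mult.assoc mult.commute[of "inverse g"])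
qed

theorem mainTheorem6:
  fixes r :: nat
  shows "G r =
    1 / (1 - z_var * ((1 - T z_var ^ (2 * r)) / (1 - (T z_var)\<^sup>2)))
    * S (z_var * v_var)
        (z_var * T z_var ^ (2 * r)
           / (1 - z_var * ((1 - T z_var ^ (2 * r)) / (1 - (T z_var)\<^sup>2)))
         * v_var)"
proof -
  define B where "B = (1 - T z_var ^ (2 * r)) / (1 - (T z_var)\<^sup>2)"
  define D where "D = 1 - z_var * B"
  define E where "E = tree_gf (\<lambda>c. fps_X ^ nodes ((cut ^^ r) c) :: real fps)
    {c. even (rightmost_dist c) \<and> 2 * r \<le> rightmost_dist c}"
  define x where "x = z_var * v_var"
  define U where "U = T x"
  define p where "p = z_var * T z_var ^ (2 * r)"
  define t where "t = p / D * v_var"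
  define q where "q = x * t / (1 - t - U\<^sup>2)"
  define i where "i = 1 / D"
  have T0: "fps_nth (1 - (T z_var)\<^sup>2) 0 = 1"
    by (simp add: T_nth_0 power2_eq_square)
  have D0: "fps_nth D 0 = 1"
    by (simp add: D_def)
  have iD: "i * D = 1" and tD: "t * D = p * v_var"
    using fps_divide_mult_cancel[OF D0, of 1] fps_divide_mult_cancel[OF D0, of p]
    by (simp_all add: i_def t_def mult_ac)
  \<comment> \<open>Since \<open>t\<close> contains a quotient, its constant term is read off from
    \<open>t * D\<close>, where \<open>D\<close> has constant term 1.\<close>
  have "fps_nth (t * D) 0 = 0"
    unfolding tD by (simp add: p_def)
  then have t0: "fps_nth t 0 = 0"
    using D0 by simp
  have N0: "fps_nth (1 - t - U\<^sup>2) 0 = 1"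
    by (simp add: t0 U_def T_nth_0 power2_eq_square)
  have q: "q * (1 - t - U\<^sup>2) = x * t"
    unfolding q_def by (rule fps_divide_mult_cancel[OF N0])
  \<comment> \<open>The geometric sum identifies the quotient \<open>B\<close> with the finite sum
    counting vanishing branches.\<close>
  have "(1 - (T z_var)\<^sup>2) * (\<Sum>j<r. ((T z_var)\<^sup>2) ^ j) = 1 - T z_var ^ (2 * r)"
    by (simp add: one_diff_power_eq power_mult)
  moreover have "(1 - (T z_var)\<^sup>2) * B = 1 - T z_var ^ (2 * r)"
    unfolding B_def using fps_divide_mult_cancel[OF T0] by (simp add: mult.commute)
  moreover have "1 - (T z_var)\<^sup>2 \<noteq> 0"
    using T0 by force
  ultimately have "B = (\<Sum>j<r. ((T z_var)\<^sup>2) ^ j)"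
    by (metis mult_left_cancel)
  then have "G r = x + G r * (z_var * B + E)"
    using G_linear_equation[of r] by (simp add: tree_gf_short_branches E_def x_def)
  then have GE: "G r * (D - E) = x"
    by (simp add: D_def algebra_simps)
  have "E = p * v_var + U\<^sup>2 * E"
    using tree_gf_long_branches[of r] by (simp add: E_def p_def U_def x_def mult_ac)
  then have E: "E * (1 - U\<^sup>2) = t * D"
    using tD by (simp add: algebra_simps)
  \<comment> \<open>Both denominators are cleared: the relation for \<open>E\<close> gives
    \<open>D * (1 - t - U\<^sup>2) = (D - E) * (1 - U\<^sup>2)\<close>, which turns the factor
    \<open>D - E\<close> from \<open>GE\<close> into the denominator of \<open>S\<close>. The common
    factor is cancelled at the end in an integral domain.\<close>
  have "G r * (D * (1 - t - U\<^sup>2)) = G r * (D * (1 - U\<^sup>2) - t * D)"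
    by (simp add: algebra_simps)
  also have "\<dots> = G r * (D - E) * (1 - U\<^sup>2)"
    by (simp only: E[symmetric]) (simp add: algebra_simps)
  also have "\<dots> = x * (1 - t - U\<^sup>2) + q * (1 - t - U\<^sup>2)"
    unfolding GE q by (simp add: algebra_simps)
  also have "\<dots> = i * D * (x + q) * (1 - t - U\<^sup>2)"
    unfolding iD by (simp add: algebra_simps)
  finally have "G r * (D * (1 - t - U\<^sup>2)) = i * (x + q) * (D * (1 - t - U\<^sup>2))"
    by (simp add: mult_ac)
  moreover have "D \<noteq> 0" "1 - t - U\<^sup>2 \<noteq> 0"
    using D0 N0 by (metis fps_zero_nth zero_neq_one)+
  ultimately have "G r = i * (x + q)"
    by simp
  then show ?thesis
    by (simp add: S_def i_def q_def t_def p_def U_def x_def D_def B_def)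
qed

end
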